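(* Fix $\mathbf{a}\in\mathbb{R}^{n_{\mathrm e}}_{\ge0}$ and $\omega>0$, and set $\mathbf{S}:=\mathbf{K}(\mathbf{a})-\omega^2\mathbf{M}(\mathbf{a})\in\mathbb{S}^{n_{\mathrm{dof}}}$. For any $\mathbf{f}_{\mathrm R}\in\mathbb{R}^{n_{\mathrm{dof}}}$ define $\mathbf{u}_{\mathrm R}:=\mathbf{S}^{\dagger}\mathbf{f}_{\mathrm R}$ and $\mathbf{v}_{\mathrm R}:=\mathbf{S}^{\dagger}(\omega\mathbf{f}_{\mathrm R})$. Then $\mathbf{v}_{\mathrm R}=\omega\mathbf{u}_{\mathrm R}$ and, with $d_{\mathrm R}:=\mathbf{f}_{\mathrm R}^{\mathsf T}\mathbf{u}_{\mathrm R}$ and $p_{\mathrm R}:=\frac12\mathbf{f}_{\mathrm R}^{\mathsf T}\mathbf{v}_{\mathrm R}$, one has $d_{\mathrm R}=\frac{2p_{\mathrm R}}{\omega}$.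
   Context: For $\mathbf{a}\in\mathbb{R}^{n_{\mathrm e}}_{\ge 0}$ the stiffness and mass matrices are $\mathbf{K}(\mathbf{a})=\sum_{e=1}^{n_{\mathrm e}}\big[a_e\mathbf{K}^{(1)}_e+a_e^2\mathbf{K}^{(2)}_e+a_e^3\mathbf{K}^{(3)}_e\big]$ and $\mathbf{M}(\mathbf{a})=\mathbf{M}^{(0)}+\sum_{e=1}^{n_{\mathrm e}}a_e\mathbf{M}^{(1)}_e$, where all $\mathbf{K}^{(i)}_e$, $\mathbf{M}^{(0)}$, $\mathbf{M}^{(1)}_e$ are fixed real symmetric positive semidefinite $n_{\mathrm{dof}}\times n_{\mathrm{dof}}$ matrices. $\mathbb{S}^{n}$ is the space of real symmetric $n\times n$ matrices and $(\cdot)^{\dagger}$ is the Moore-Penrose pseudoinverse. $\mathbf{u}_{\mathrm R}$ and $\mathbf{v}_{\mathrm R}$ are called the minimal-norm displacement and velocity amplitudes. *)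

theory Defs
  imports "HOL-Analysis.Analysis"
begin

definition sym_matrix :: "real^'n^'n \<Rightarrow> bool" where
  "sym_matrix A \<longleftrightarrow> transpose A = A"

definition psd_matrix :: "real^'n^'n \<Rightarrow> bool" where
  "psd_matrix A \<longleftrightarrow> sym_matrix A \<and> (\<forall>x. 0 \<le> x \<bullet> (A *v x))"

definition stiffness ::
  "('e::finite \<Rightarrow> real^'n^'n) \<Rightarrow> ('e \<Rightarrow> real^'n^'n) \<Rightarrow> ('e \<Rightarrow> real^'n^'n)
    \<Rightarrow> real^'e \<Rightarrow> real^'n^'n" where
  "stiffness K1 K2 K3 a =
     (\<Sum>e\<in>UNIV. (a $ e) *\<^sub>R K1 e + (a $ e)^2 *\<^sub>R K2 e + (a $ e)^3 *\<^sub>R K3 e)"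

definition mass ::
  "real^'n^'n \<Rightarrow> ('e::finite \<Rightarrow> real^'n^'n) \<Rightarrow> real^'e \<Rightarrow> real^'n^'n" where
  "mass M0 M1 a = M0 + (\<Sum>e\<in>UNIV. (a $ e) *\<^sub>R M1 e)"

text \<open>The four Penrose conditions; over the reals the adjoint is the transpose.\<close>

definition is_pinv :: "real^'n^'m \<Rightarrow> real^'m^'n \<Rightarrow> bool" where
  "is_pinv A X \<longleftrightarrow>
     A ** X ** A = A \<and> X ** A ** X = X \<and>
     transpose (A ** X) = A ** X \<and> transpose (X ** A) = X ** A"

definition pinv :: "real^'n^'m \<Rightarrow> real^'m^'n" where
  "pinv A = (THE X. is_pinv A X)"

text \<open>The definite description is well defined: every real matrix has exactly one
  pseudoinverse.\<close>

lemma is_pinv_unique: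
  fixes A :: "real^'n^'m"
  assumes "is_pinv A X" "is_pinv A Y"
  shows "X = Y"
proof -
  have X: "A ** X ** A = A" "X ** A ** X = X"
      "transpose (A ** X) = A ** X" "transpose (X ** A) = X ** A"
    and Y: "A ** Y ** A = A" "Y ** A ** Y = Y"
      "transpose (A ** Y) = A ** Y" "transpose (Y ** A) = Y ** A"
    using assms by (auto simp: is_pinv_def)
  have "A ** X = transpose (A ** Y ** A ** X)"
    using X Y by simp
  also have "\<dots> = transpose ((A ** Y) ** (A ** X))"
    by (simp add: matrix_mul_assoc)
  also have "\<dots> = (A ** X) ** (A ** Y)"
    by (subst matrix_transpose_mul) (simp add: X Y)
  also have "\<dots> = A ** Y"
    using X(1) by (simp add: matrix_mul_assoc)
  finally have AX: "A ** X = A ** Y" .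
  have "X ** A = transpose (X ** (A ** Y ** A))"
    using X Y by simp
  also have "\<dots> = transpose ((X ** A) ** (Y ** A))"
    by (simp add: matrix_mul_assoc)
  also have "\<dots> = (Y ** A) ** (X ** A)"
    by (subst matrix_transpose_mul) (simp add: X Y)
  also have "\<dots> = Y ** (A ** X ** A)"
    by (simp add: matrix_mul_assoc)
  also have "\<dots> = Y ** A"
    using X(1) by simp
  finally have XA: "X ** A = Y ** A" .
  have "X = Y ** A ** X"
    using X(2) XA by simp
  also have "\<dots> = Y ** (A ** X)"
    by (simp add: matrix_mul_assoc)
  also have "\<dots> = Y"
    using Y(2) AX by (simp add: matrix_mul_assoc)
  finally show ?thesis .
qed

lemma is_pinv_exists:
  fixes A :: "real^'n^'m"
  shows "\<exists>X. is_pinv A X"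
proof -
  define N where "N = {x. A *v x = 0}"
  define R where "R = range ((*v) A)"
  have subN: "subspace N"
    unfolding N_def subspace_def by (simp add: matrix_vector_right_distrib matrix_vector_mult_scaleR)
  have subR: "subspace R"
    unfolding R_def by (intro linear_subspace_image matrix_vector_mul_linear subspace_UNIV)
  define P where "P = (\<lambda>y x. (\<forall>z\<in>N. x \<bullet> z = 0) \<and> (\<forall>w. (y - A *v x) \<bullet> (A *v w) = 0))"
  have ex: "\<exists>x. P y x" for y
  proof -
    obtain r s where r: "r \<in> span R" and s: "\<And>w. w \<in> span R \<Longrightarrow> orthogonal s w"
      and y: "y = r + s"
      using orthogonal_subspace_decomp_exists[of R y] by blast
    from r obtain x0 where x0: "r = A *v x0"
      using subR by (auto simp: R_def span_eq_iff[THEN iffD2])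
    obtain k x where k: "k \<in> span N" and x: "\<And>w. w \<in> span N \<Longrightarrow> orthogonal x w"
      and x0': "x0 = k + x"
      using orthogonal_subspace_decomp_exists[of N x0] by blast
    have "A *v k = 0"
      using k subN by (auto simp: N_def span_eq_iff[THEN iffD2])
    hence "A *v x = r"
      using x0 x0' by (simp add: matrix_vector_right_distrib)
    hence "P y x"
      using s x y unfolding P_def orthogonal_def R_def by (auto intro: span_base)
    thus ?thesis ..
  qed
  have uniq: "x = x'" if "P y x" "P y x'" for y x x'
  proof -
    have "A *v (x - x') = (y - A *v x') - (y - A *v x)"
      by (simp add: matrix_vector_mult_diff_distrib)
    moreover have "((y - A *v x') - (y - A *v x)) \<bullet> (A *v (x - x')) = 0"
      using that unfolding P_def by (subst inner_diff_left) simp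
    ultimately have "A *v (x - x') = 0"
      by (metis inner_eq_zero_iff)
    hence "(x - x') \<bullet> (x - x') = 0"
      using that unfolding P_def N_def by (subst inner_diff_left) auto
    thus ?thesis by simp
  qed
  define g where "g = (\<lambda>y. SOME x. P y x)"
  have g: "P y (g y)" for y
    unfolding g_def using ex by (rule someI_ex)
  have lin: "linear g"
  proof (rule linearI)
    fix y z
    have "P (y + z) (g y + g z)"
      using g[of y] g[of z] unfolding P_def
      by (simp add: matrix_vector_right_distrib inner_add_left inner_diff_left)
    thus "g (y + z) = g y + g z"
      using uniq g by blast
  next
    fix c y
    have "P (c *\<^sub>R y) (c *\<^sub>R g y)"
      using g[of y] unfolding P_def
      by (simp add: matrix_vector_mult_scaleR inner_diff_left)
    thus "g (c *\<^sub>R y) = c *\<^sub>R g y"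
      using uniq g by blast
  qed
  define X where "X = matrix g"
  have Xv: "X *v y = g y" for y
    unfolding X_def using lin by (simp add: matrix_works)
  have perp: "g y \<bullet> z = 0" if "A *v z = 0" for y z
    using g[of y] that unfolding P_def N_def by simp
  have res: "(y - A *v g y) \<bullet> (A *v w) = 0" for y w
    using g[of y] unfolding P_def by simp
  have AgA: "A *v g (A *v x) = A *v x" for x
  proof -
    have "(A *v x - A *v g (A *v x)) \<bullet> (A *v (x - g (A *v x))) = 0"
      by (rule res)
    thus ?thesis by (simp add: matrix_vector_mult_diff_distrib)
  qed
  have gAg: "g (A *v g y) = g y" for y
  proof -
    have "A *v (g (A *v g y) - g y) = 0"
      by (simp add: matrix_vector_mult_diff_distrib AgA)
    hence "(g (A *v g y) - g y) \<bullet> (g (A *v g y) - g y) = 0"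
      using perp by (subst inner_diff_left) simp
    thus ?thesis by simp
  qed
  have symI: "transpose B = B" if "\<And>x y. (B *v x) \<bullet> y = x \<bullet> (B *v y)" for B :: "real^'k^'k"
  proof -
    have "(transpose B *v x) \<bullet> y = (B *v x) \<bullet> y" for x y
      using that by (metis dot_lmul_matrix transpose_matrix_vector)
    thus ?thesis
      by (metis matrix_eq vector_eq_rdot)
  qed
  have s1: "transpose (A ** X) = A ** X"
  proof (rule symI)
    fix x y
    have "(A *v g x) \<bullet> y = (A *v g x) \<bullet> (A *v g y)"
      using res[of y "g x"] inner_commute[of y "A *v g x"] inner_commute[of "A *v g y" "A *v g x"]
      by (simp add: inner_diff_left)
    moreover have "x \<bullet> (A *v g y) = (A *v g x) \<bullet> (A *v g y)"
      using res[of x "g y"] by (simp add: inner_diff_left)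
    ultimately show "((A ** X) *v x) \<bullet> y = x \<bullet> ((A ** X) *v y)"
      by (simp add: matrix_vector_mul_assoc[symmetric] Xv)
  qed
  have s2: "transpose (X ** A) = X ** A"
  proof (rule symI)
    fix x y
    have k: "A *v (z - g (A *v z)) = 0" for z
      by (simp add: matrix_vector_mult_diff_distrib AgA)
    have "g (A *v x) \<bullet> y = g (A *v x) \<bullet> g (A *v y)"
      using perp[OF k[of y], of "A *v x"] by (simp add: inner_diff_right)
    moreover have "x \<bullet> g (A *v y) = g (A *v x) \<bullet> g (A *v y)"
      using perp[OF k[of x], of "A *v y"] inner_commute[of x "g (A *v y)"]
        inner_commute[of "g (A *v x)" "g (A *v y)"]
      by (simp add: inner_diff_right)
    ultimately show "((X ** A) *v x) \<bullet> y = x \<bullet> ((X ** A) *v y)"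
      by (simp add: matrix_vector_mul_assoc[symmetric] Xv)
  qed
  have "A ** X ** A = A" "X ** A ** X = X"
    by (simp_all add: matrix_eq matrix_vector_mul_assoc[symmetric] Xv AgA gAg)
  with s1 s2 show ?thesis
    unfolding is_pinv_def by blast
qed

lemma is_pinv_pinv: "is_pinv A (pinv A)"
  unfolding pinv_def using is_pinv_exists is_pinv_unique by (metis theI')

lemma sym_matrix_dynamic_stiffness:
  assumes "\<And>e. psd_matrix (K1 e)" "\<And>e. psd_matrix (K2 e)" "\<And>e. psd_matrix (K3 e)"
    and "psd_matrix M0" "\<And>e. psd_matrix (M1 e)"
  shows "sym_matrix (stiffness K1 K2 K3 a - \<omega>\<^sup>2 *\<^sub>R mass M0 M1 a)"
proof -
  have "K1 e $ i $ j = K1 e $ j $ i" "K2 e $ i $ j = K2 e $ j $ i" "K3 e $ i $ j = K3 e $ j $ i"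
    "M0 $ i $ j = M0 $ j $ i" "M1 e $ i $ j = M1 e $ j $ i" for e i j
    using assms unfolding psd_matrix_def sym_matrix_def transpose_def
    by (metis vec_lambda_beta)+
  thus ?thesis
    unfolding sym_matrix_def transpose_def stiffness_def mass_def vec_eq_iff
    by (auto intro!: sum.cong arg_cong2[of _ _ _ _ "(-)"] arg_cong2[of _ _ _ _ "(+)"])
qed

end

theory Submission
  imports Defs
begin

text \<open>Both identities express the linearity of the pseudoinverse \<open>S\<^sup>\<dagger>\<close> as an operator on loads: scaling the
  load amplitude by \<open>\<omega>\<close> scales the response, and hence its pairing with the fixed load \<open>f\<^sub>R\<close>, by
  \<open>\<omega>\<close>. Dividing this factor out of the power gives the
  second identity.\<close>

theorem lemma4:
  fixes K1 K2 K3 M1 :: "'e::finite \<Rightarrow> real^'n^'n"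
    and M0 S :: "real^'n^'n"
    and a :: "real^'e"
    and f\<^sub>R u\<^sub>R v\<^sub>R :: "real^'n"
    and \<omega> d\<^sub>R p\<^sub>R :: real
  assumes "\<And>e. psd_matrix (K1 e)" and "\<And>e. psd_matrix (K2 e)" and "\<And>e. psd_matrix (K3 e)"
    and "psd_matrix M0" and "\<And>e. psd_matrix (M1 e)"
    and "\<And>e. 0 \<le> a $ e"
    and "0 < \<omega>"
    and "S = stiffness K1 K2 K3 a - \<omega>\<^sup>2 *\<^sub>R mass M0 M1 a"
    and "u\<^sub>R = pinv S *v f\<^sub>R"
    and "v\<^sub>R = pinv S *v (\<omega> *\<^sub>R f\<^sub>R)"
    and "d\<^sub>R = f\<^sub>R \<bullet> u\<^sub>R"
    and "p\<^sub>R = 1 / 2 * (f\<^sub>R \<bullet> v\<^sub>R)"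
  shows "v\<^sub>R = \<omega> *\<^sub>R u\<^sub>R \<and> d\<^sub>R = 2 * p\<^sub>R / \<omega>"
proof -
  have v: "v\<^sub>R = \<omega> *\<^sub>R u\<^sub>R"
    using assms(9,10) by (simp add: matrix_vector_mult_scaleR)
  moreover have "2 * p\<^sub>R = \<omega> * d\<^sub>R"
    using assms(11,12) v by simp
  ultimately show ?thesis
    using \<open>0 < \<omega>\<close> by simp
qed

end
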